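(* Let $V$ be a simple semi-free semi-vector space over $\mathbb{R}_0^+$ of semi-dimension $n$. Then $V$ is isomorphic to $(\mathbb{R}_0^+)^n$, i.e., there is a bijective semi-linear transformation $V\to(\mathbb{R}_0^+)^n$, where $(\mathbb{R}_0^+)^n$ carries coordinatewise addition and scalar multiplication.
   Context: $\mathbb{R}_0^+=[0,\infty)$. A semi-vector space over $\mathbb{R}_0^+$ is a set $V$ with operations $+:V\times V\to V$ and $\cdot:\mathbb{R}_0^+\times V\to V$ such that: (1) $(V,+)$ is an abelian monoid (with identity $0_V$) satisfying the cancellation law $u+v=u+w\Rightarrow v=w$; (2) $\alpha(u+v)=\alpha u+\alpha v$; (3) $(\alpha+\beta)v=\alpha v+\beta v$; (4) $(\alpha\beta)v=\alpha(\beta v)$; (5) $1v=v$. $V$ is simple if $u+v=0_V$ implies $u=v=0_V$. A semi-basis of a simple semi-vector space $V$ is a subset $B\subset V$ (of nonzero vectors) such that every $v\in V$, $v\ne 0_V$, can be written in a unique way as a finite sum $v=\sum_{i\in I_v}v^{(i)}b_i$ with $v^{(i)}>0$ and $b_i\in B$ distinct, the finite index set $I_v$ being uniquely determined by $v$. $V$ is semi-free if it admits a semi-basis; all semi-bases then have the same cardinality, called the semi-dimension of $V$. A semi-linear transformation between semi-vector spaces is a map $T$ with $T(u+v)=T(u)+T(v)$ and $T(\lambda v)=\lambda T(v)$ for all vectors $u,v$ and all $\lambda\in\mathbb{R}_0^+$. *)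

theory Defs
  imports Complex_Main "HOL-Library.Extended_Nat" "HOL-Algebra.Module"
begin

text \<open>
  Semi-vector spaces over the semiring of nonnegative reals. We reuse the record of
  \<^theory>\<open>HOL-Algebra.Module\<close> with scalar type \<^typ>\<open>real\<close>: its carrier, addition, zero and
  scalar multiplication are the data of the space, and (as for the modules of that theory) its
  fields for ring multiplication and unit play no role. Scalar multiplication is only constrained
  at nonnegative scalars.
\<close>

locale semi_vector_space = abelian_monoid V
  for V :: "(real, 'v, 'm) module_scheme" (structure) +
  assumes add_cancel:
      "\<lbrakk>u \<in> carrier V; v \<in> carrier V; w \<in> carrier V; u \<oplus> v = u \<oplus> w\<rbrakk> \<Longrightarrow> v = w"
    and smult_closed: "\<lbrakk>0 \<le> a; v \<in> carrier V\<rbrakk> \<Longrightarrow> a \<odot>\<^bsub>V\<^esub> v \<in> carrier V"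
    and smult_r_distr: "\<lbrakk>0 \<le> a; u \<in> carrier V; v \<in> carrier V\<rbrakk>
      \<Longrightarrow> a \<odot>\<^bsub>V\<^esub> (u \<oplus> v) = a \<odot>\<^bsub>V\<^esub> u \<oplus> a \<odot>\<^bsub>V\<^esub> v"
    and smult_l_distr: "\<lbrakk>0 \<le> a; 0 \<le> b; v \<in> carrier V\<rbrakk>
      \<Longrightarrow> (a + b) \<odot>\<^bsub>V\<^esub> v = a \<odot>\<^bsub>V\<^esub> v \<oplus> b \<odot>\<^bsub>V\<^esub> v"
    and smult_assoc: "\<lbrakk>0 \<le> a; 0 \<le> b; v \<in> carrier V\<rbrakk>
      \<Longrightarrow> (a * b) \<odot>\<^bsub>V\<^esub> v = a \<odot>\<^bsub>V\<^esub> (b \<odot>\<^bsub>V\<^esub> v)"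
    and smult_one: "v \<in> carrier V \<Longrightarrow> 1 \<odot>\<^bsub>V\<^esub> v = v"

locale simple_semi_vector_space = semi_vector_space +
  assumes simple: "\<lbrakk>u \<in> carrier V; v \<in> carrier V; u \<oplus> v = \<zero>\<rbrakk> \<Longrightarrow> u = \<zero> \<and> v = \<zero>"

text \<open>
  A representation of \<open>v\<close> over \<open>B\<close> is a pair of a finite subset \<open>I\<close> of \<open>B\<close> and positive
  coefficients on \<open>I\<close>. Indexing by the vectors themselves makes them distinct; the coefficient
  function is extensional (it is \<^const>\<open>undefined\<close> outside \<open>I\<close>), so that uniqueness of the pair
  is uniqueness of \<open>I\<close> together with uniqueness of the coefficients on \<open>I\<close>.
\<close>

definition semi_reps ::
    "(real, 'v, 'm) module_scheme \<Rightarrow> 'v set \<Rightarrow> 'v \<Rightarrow> ('v set \<times> ('v \<Rightarrow> real)) set" where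
  "semi_reps V B v = {(I, c). finite I \<and> I \<subseteq> B \<and> c \<in> I \<rightarrow>\<^sub>E {0<..} \<and>
      v = (\<Oplus>\<^bsub>V\<^esub>b\<in>I. c b \<odot>\<^bsub>V\<^esub> b)}"

definition semi_basis :: "(real, 'v, 'm) module_scheme \<Rightarrow> 'v set \<Rightarrow> bool" where
  "semi_basis V B \<longleftrightarrow> B \<subseteq> carrier V - {\<zero>\<^bsub>V\<^esub>} \<and>
      (\<forall>v \<in> carrier V - {\<zero>\<^bsub>V\<^esub>}. \<exists>!r. r \<in> semi_reps V B v)"

definition semi_free :: "(real, 'v, 'm) module_scheme \<Rightarrow> bool" where
  "semi_free V \<longleftrightarrow> (\<exists>B. semi_basis V B)"

text \<open>
  The common cardinality of the semi-bases of a simple semi-free space; \<open>\<infinity>\<close> when they are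
  infinite, so that a space with infinite semi-bases is not confused with one of semi-dimension 0.
\<close>

definition semi_dim :: "(real, 'v, 'm) module_scheme \<Rightarrow> enat" where
  "semi_dim V = (let B = (SOME B. semi_basis V B) in if finite B then enat (card B) else \<infinity>)"

definition semi_linear ::
    "(real, 'v, 'm) module_scheme \<Rightarrow> (real, 'w, 'k) module_scheme \<Rightarrow> ('v \<Rightarrow> 'w) \<Rightarrow> bool" where
  "semi_linear V W T \<longleftrightarrow> T \<in> carrier V \<rightarrow> carrier W \<and>
      (\<forall>u \<in> carrier V. \<forall>v \<in> carrier V. T (u \<oplus>\<^bsub>V\<^esub> v) = T u \<oplus>\<^bsub>W\<^esub> T v) \<and>
      (\<forall>a \<ge> 0. \<forall>v \<in> carrier V. T (a \<odot>\<^bsub>V\<^esub> v) = a \<odot>\<^bsub>W\<^esub> T v)"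

definition nonneg_tuples :: "nat \<Rightarrow> (real, nat \<Rightarrow> real) module" where
  "nonneg_tuples n = \<lparr>
      carrier = {..<n} \<rightarrow>\<^sub>E {0..},
      mult = undefined, one = undefined,
      zero = (\<lambda>i\<in>{..<n}. 0),
      add = (\<lambda>x y. \<lambda>i\<in>{..<n}. x i + y i),
      smult = (\<lambda>a x. \<lambda>i\<in>{..<n}. a * x i)\<rparr>"

lemma simple_semi_vector_space_nonneg_tuples: "simple_semi_vector_space (nonneg_tuples n)"
proof -
  let ?W = "nonneg_tuples n"
  have ext: "x = y" if "x \<in> carrier ?W" "y \<in> carrier ?W" "\<And>i. i < n \<Longrightarrow> x i = y i" for x y
    using that by (intro PiE_ext[of x "{..<n}" "\<lambda>_. {0..}"]) (auto simp: nonneg_tuples_def)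
  have closed: "x \<oplus>\<^bsub>?W\<^esub> y \<in> carrier ?W" if "x \<in> carrier ?W" "y \<in> carrier ?W" for x y
    using that by (auto simp: nonneg_tuples_def PiE_iff)
  have smult: "a \<odot>\<^bsub>?W\<^esub> x \<in> carrier ?W" if "0 \<le> a" "x \<in> carrier ?W" for a x
    using that by (auto simp: nonneg_tuples_def PiE_iff)
  have zero: "\<zero>\<^bsub>?W\<^esub> \<in> carrier ?W"
    by (auto simp: nonneg_tuples_def)
  have nonneg: "0 \<le> x i" if "x \<in> carrier ?W" "i < n" for x i
    using that by (auto simp: nonneg_tuples_def PiE_iff)
  have nth: "(x \<oplus>\<^bsub>?W\<^esub> y) i = x i + y i" "(a \<odot>\<^bsub>?W\<^esub> x) i = a * x i" "\<zero>\<^bsub>?W\<^esub> i = 0"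
    if "i < n" for x y a i
    using that by (simp_all add: nonneg_tuples_def)
  have "abelian_monoid ?W"
    by (rule abelian_monoidI) (auto intro!: ext closed zero simp: nth)
  moreover have "semi_vector_space_axioms ?W"
  proof
    fix u v w
    assume "u \<in> carrier ?W" "v \<in> carrier ?W" "w \<in> carrier ?W" "u \<oplus>\<^bsub>?W\<^esub> v = u \<oplus>\<^bsub>?W\<^esub> w"
    then show "v = w"
      by (metis ext nth(1) add_left_cancel)
  qed (auto intro!: ext closed smult simp: nth algebra_simps)
  moreover have "simple_semi_vector_space_axioms ?W"
  proof
    fix u v
    assume uv: "u \<in> carrier ?W" "v \<in> carrier ?W" "u \<oplus>\<^bsub>?W\<^esub> v = \<zero>\<^bsub>?W\<^esub>"
    have "u i = 0 \<and> v i = 0" if "i < n" for i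
      using nth(1,3)[OF that] nonneg[OF uv(1) that] nonneg[OF uv(2) that] uv(3)
      by (metis add_nonneg_eq_0_iff)
    then show "u = \<zero>\<^bsub>?W\<^esub> \<and> v = \<zero>\<^bsub>?W\<^esub>"
      using uv by (auto intro!: ext zero simp: nth)
  qed
  ultimately show ?thesis
    by (simp add: simple_semi_vector_space_def semi_vector_space_def)
qed

end

theory Submission
  imports Defs
begin

text \<open>
  Over a finite semi-basis \<open>B\<close>, pad the coefficients of a representation by \<open>0\<close> outside its index
  set. Uniqueness of representations then says that each nonzero vector is \<open>\<Sum>b\<in>B. c b b\<close> for
  exactly one \<open>c : B \<rightarrow> [0,\<infinity>)\<close>; for the zero vector the same holds because \<open>V\<close> is simple. Hence
  \<open>c \<mapsto> \<Sum>b\<in>B. c b b\<close> is a semi-linear bijection, and its inverse is the isomorphism.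
\<close>

context semi_vector_space
begin

text \<open>Cancellation does the work of additive inverses: by distributivity the product
  \<open>x\<close> satisfies \<open>x \<oplus> x = x = x \<oplus> \<zero>\<close>. The next lemma
  runs the same way.\<close>

lemma smult_zero_left:
  assumes "v \<in> carrier V" shows "0 \<odot>\<^bsub>V\<^esub> v = \<zero>"
proof (rule add_cancel)
  show "0 \<odot>\<^bsub>V\<^esub> v \<oplus> 0 \<odot>\<^bsub>V\<^esub> v = 0 \<odot>\<^bsub>V\<^esub> v \<oplus> \<zero>"
    using smult_l_distr[of 0 0 v] assms smult_closed by simp
qed (use assms smult_closed in auto)

lemma smult_zero_right:
  assumes "0 \<le> a" shows "a \<odot>\<^bsub>V\<^esub> \<zero> = \<zero>"
proof (rule add_cancel)
  show "a \<odot>\<^bsub>V\<^esub> \<zero> \<oplus> a \<odot>\<^bsub>V\<^esub> \<zero> = a \<odot>\<^bsub>V\<^esub> \<zero> \<oplus> \<zero>"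
    using smult_r_distr[of a \<zero> \<zero>] assms smult_closed by simp
qed (use assms smult_closed in auto)

lemma smult_eq_zero_iff:
  assumes "0 \<le> a" "v \<in> carrier V"
  shows "a \<odot>\<^bsub>V\<^esub> v = \<zero> \<longleftrightarrow> a = 0 \<or> v = \<zero>"
proof
  assume zero: "a \<odot>\<^bsub>V\<^esub> v = \<zero>"
  show "a = 0 \<or> v = \<zero>"
  proof (cases "a = 0")
    case False
    then have "v = (1 / a * a) \<odot>\<^bsub>V\<^esub> v"
      using assms smult_one by simp
    also have "\<dots> = (1 / a) \<odot>\<^bsub>V\<^esub> (a \<odot>\<^bsub>V\<^esub> v)"
      using assms by (intro smult_assoc) auto
    finally show ?thesis
      using assms zero smult_zero_right by simp
  qed simp
qed (use assms smult_zero_left smult_zero_right in auto)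

lemma finsum_smult:
  assumes "0 \<le> a" "finite A" "f \<in> A \<rightarrow> carrier V"
  shows "(\<Oplus>x\<in>A. a \<odot>\<^bsub>V\<^esub> f x) = a \<odot>\<^bsub>V\<^esub> (\<Oplus>x\<in>A. f x)"
  using assms(2,3)
proof (induction A rule: finite_induct)
  case (insert x A)
  then have "(\<Oplus>y\<in>insert x A. a \<odot>\<^bsub>V\<^esub> f y) = a \<odot>\<^bsub>V\<^esub> f x \<oplus> (\<Oplus>y\<in>A. a \<odot>\<^bsub>V\<^esub> f y)"
    using assms(1) smult_closed by (intro finsum_insert) auto
  also have "\<dots> = a \<odot>\<^bsub>V\<^esub> (f x \<oplus> (\<Oplus>y\<in>A. f y))"
    using insert assms(1) by (subst smult_r_distr) auto
  finally show ?case
    using insert by auto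
qed (simp add: assms(1) smult_zero_right)

lemma finsum_lincomb_add:
  assumes "B \<subseteq> carrier V" "c \<in> B \<rightarrow> {0..}" "d \<in> B \<rightarrow> {0..}"
  shows "(\<Oplus>b\<in>B. (c b + d b) \<odot>\<^bsub>V\<^esub> b) = (\<Oplus>b\<in>B. c b \<odot>\<^bsub>V\<^esub> b) \<oplus> (\<Oplus>b\<in>B. d b \<odot>\<^bsub>V\<^esub> b)"
proof -
  have "(\<Oplus>b\<in>B. (c b + d b) \<odot>\<^bsub>V\<^esub> b) = (\<Oplus>b\<in>B. c b \<odot>\<^bsub>V\<^esub> b \<oplus> d b \<odot>\<^bsub>V\<^esub> b)"
    using assms smult_closed
    by (intro finsum_cong' refl smult_l_distr) (auto simp: Pi_iff subset_iff)
  also have "\<dots> = (\<Oplus>b\<in>B. c b \<odot>\<^bsub>V\<^esub> b) \<oplus> (\<Oplus>b\<in>B. d b \<odot>\<^bsub>V\<^esub> b)"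
    using assms smult_closed by (intro finsum_addf) (auto simp: Pi_iff subset_iff)
  finally show ?thesis .
qed

lemma finsum_lincomb_smult:
  assumes "finite B" "B \<subseteq> carrier V" "0 \<le> a" "c \<in> B \<rightarrow> {0..}"
  shows "(\<Oplus>b\<in>B. (a * c b) \<odot>\<^bsub>V\<^esub> b) = a \<odot>\<^bsub>V\<^esub> (\<Oplus>b\<in>B. c b \<odot>\<^bsub>V\<^esub> b)"
proof -
  have "(\<Oplus>b\<in>B. (a * c b) \<odot>\<^bsub>V\<^esub> b) = (\<Oplus>b\<in>B. a \<odot>\<^bsub>V\<^esub> (c b \<odot>\<^bsub>V\<^esub> b))"
    using assms smult_closed
    by (intro finsum_cong' refl smult_assoc) (auto simp: Pi_iff subset_iff)
  also have "\<dots> = a \<odot>\<^bsub>V\<^esub> (\<Oplus>b\<in>B. c b \<odot>\<^bsub>V\<^esub> b)"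
    using assms smult_closed by (intro finsum_smult) (auto simp: Pi_iff subset_iff)
  finally show ?thesis .
qed

text \<open>Terms outside \<open>I\<close> have coefficient 0 and vanish. This is the passage
  between sums over the index set of a representation and sums over all of \<open>B\<close>.\<close>

lemma finsum_lincomb_support:
  assumes "finite B" "B \<subseteq> carrier V" "I \<subseteq> B" "c \<in> B \<rightarrow> {0..}" "\<And>b. b \<in> B - I \<Longrightarrow> c b = 0"
  shows "(\<Oplus>b\<in>I. c b \<odot>\<^bsub>V\<^esub> b) = (\<Oplus>b\<in>B. c b \<odot>\<^bsub>V\<^esub> b)"
  using assms smult_closed smult_zero_left
  by (intro add.finprod_mono_neutral_cong_left) (auto simp: Pi_iff subset_iff)

text \<open>On its support a nonnegative coefficient function is positive, as
  \<open>semi_reps\<close> demands; the restriction makes it extensional there. Coefficients on all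
  of \<open>B\<close> thereby fall under the uniqueness of representations.\<close>

lemma support_in_semi_reps:
  assumes "finite B" "B \<subseteq> carrier V" "c \<in> B \<rightarrow> {0..}"
  shows "({b\<in>B. c b \<noteq> 0}, restrict c {b\<in>B. c b \<noteq> 0}) \<in> semi_reps V B (\<Oplus>b\<in>B. c b \<odot>\<^bsub>V\<^esub> b)"
proof -
  let ?I = "{b\<in>B. c b \<noteq> 0}"
  have "(\<Oplus>b\<in>B. c b \<odot>\<^bsub>V\<^esub> b) = (\<Oplus>b\<in>?I. c b \<odot>\<^bsub>V\<^esub> b)"
    using assms by (intro finsum_lincomb_support[symmetric]) auto
  also have "\<dots> = (\<Oplus>b\<in>?I. restrict c ?I b \<odot>\<^bsub>V\<^esub> b)"
    using assms smult_closed by (intro finsum_cong') (auto simp: Pi_iff subset_iff)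
  finally show ?thesis
    using assms by (auto simp: semi_reps_def Pi_iff less_le)
qed

end

context simple_semi_vector_space
begin

text \<open>Splitting off the term at \<open>x\<close> writes \<zero> as a sum of two vectors, so
  simplicity makes both vanish.\<close>

lemma finsum_eq_zeroD:
  assumes "finite A" "f \<in> A \<rightarrow> carrier V" "(\<Oplus>x\<in>A. f x) = \<zero>" "x \<in> A"
  shows "f x = \<zero>"
proof -
  have "(\<Oplus>y\<in>insert x (A - {x}). f y) = f x \<oplus> (\<Oplus>y\<in>A - {x}. f y)"
    using assms by (intro finsum_insert) auto
  then have "f x \<oplus> (\<Oplus>y\<in>A - {x}. f y) = \<zero>"
    using assms by (simp add: insert_absorb)
  moreover have "f x \<in> carrier V" "(\<Oplus>y\<in>A - {x}. f y) \<in> carrier V"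
    using assms by (auto intro!: finsum_closed)
  ultimately show ?thesis
    using simple by blast
qed

text \<open>Uniqueness of representations gives injectivity and existence gives surjectivity. The
  functions are extensional so that equal values on \<open>B\<close> mean equal functions.\<close>

lemma bij_betw_lincomb:
  assumes "finite B" "semi_basis V B"
  shows "bij_betw (\<lambda>c. \<Oplus>b\<in>B. c b \<odot>\<^bsub>V\<^esub> b) (B \<rightarrow>\<^sub>E {0..}) (carrier V)"
proof -
  let ?L = "\<lambda>c. \<Oplus>b\<in>B. c b \<odot>\<^bsub>V\<^esub> b"
  have B: "B \<subseteq> carrier V" and nz: "\<zero> \<notin> B"
    using assms(2) unfolding semi_basis_def by auto
  have ex1: "\<exists>!r. r \<in> semi_reps V B v" if "v \<in> carrier V - {\<zero>}" for v
    using assms(2) that unfolding semi_basis_def by blast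
  have terms: "(\<lambda>b. c b \<odot>\<^bsub>V\<^esub> b) \<in> B \<rightarrow> carrier V" if "c \<in> B \<rightarrow>\<^sub>E {0..}" for c
    using that B smult_closed by (auto simp: PiE_iff subset_iff)
  then have closed: "?L c \<in> carrier V" if "c \<in> B \<rightarrow>\<^sub>E {0..}" for c
    using that by (intro finsum_closed) auto
  have "inj_on ?L (B \<rightarrow>\<^sub>E {0..})"
  proof (intro inj_onI PiE_ext)
    fix c d b
    assume cd: "c \<in> B \<rightarrow>\<^sub>E {0..}" "d \<in> B \<rightarrow>\<^sub>E {0..}" "?L c = ?L d" and b: "b \<in> B"
    show "c b = d b"
    proof (cases "?L c = \<zero>")
      \<comment> \<open>\<open>semi_basis\<close> is silent about \<zero>. Here each term of the sum
        is \<zero>, and since \<open>b\<close> is a nonzero vector its coefficient must be 0, in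
        \<open>c\<close> and in \<open>d\<close> alike.\<close>
      case True
      have "e b = 0" if "e \<in> B \<rightarrow>\<^sub>E {0..}" "?L e = \<zero>" for e
      proof -
        have "e b \<odot>\<^bsub>V\<^esub> b = \<zero>"
          using finsum_eq_zeroD[OF assms(1) terms] that b by blast
        moreover have "0 \<le> e b" "b \<in> carrier V" "b \<noteq> \<zero>"
          using that b B nz by auto
        ultimately show ?thesis
          using smult_eq_zero_iff by blast
      qed
      then show ?thesis
        using cd True by metis
    next
      case False
      have "({b\<in>B. c b \<noteq> 0}, restrict c {b\<in>B. c b \<noteq> 0}) \<in> semi_reps V B (?L c)"
        using cd by (intro support_in_semi_reps assms(1) B) auto
      moreover have "({b\<in>B. d b \<noteq> 0}, restrict d {b\<in>B. d b \<noteq> 0}) \<in> semi_reps V B (?L c)"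
        unfolding cd(3) using cd by (intro support_in_semi_reps assms(1) B) auto
      ultimately have I: "{b\<in>B. c b \<noteq> 0} = {b\<in>B. d b \<noteq> 0}"
        and r: "restrict c {b\<in>B. c b \<noteq> 0} = restrict d {b\<in>B. d b \<noteq> 0}"
        using ex1[of "?L c"] False closed[OF cd(1)] by blast+
      \<comment> \<open>Off the common support both coefficients of \<open>b\<close> are 0; on it
        the two restrictions, evaluated at \<open>b\<close>, return \<open>c b\<close> and
        \<open>d b\<close>.\<close>
      show ?thesis
        using I fun_cong[OF r, of b] b by (auto simp: set_eq_iff restrict_def split: if_splits)
    qed
  qed
  moreover have "v \<in> ?L ` (B \<rightarrow>\<^sub>E {0..})" if v: "v \<in> carrier V" for v
  proof (cases "v = \<zero>")
    case True
    have "?L (\<lambda>b\<in>B. 0) = (\<Oplus>b\<in>B. \<zero>)"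
      using B smult_zero_left by (intro finsum_cong') auto
    then show ?thesis
      using True by (intro image_eqI[of _ _ "\<lambda>b\<in>B. 0"]) auto
  next
    case False
    then obtain I c where I: "I \<subseteq> B" and c: "c \<in> I \<rightarrow>\<^sub>E {0<..}"
      and v_eq: "v = (\<Oplus>b\<in>I. c b \<odot>\<^bsub>V\<^esub> b)"
      using ex1[of v] v by (auto simp: semi_reps_def)
    define d where "d = (\<lambda>b\<in>B. if b \<in> I then c b else 0)"
    have d: "d \<in> B \<rightarrow>\<^sub>E {0..}"
      using c by (auto simp: d_def PiE_iff less_imp_le)
    have "v = (\<Oplus>b\<in>I. d b \<odot>\<^bsub>V\<^esub> b)"
      unfolding v_eq using I terms[OF d] by (intro finsum_cong') (auto simp: d_def)
    also have "\<dots> = ?L d"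
      using assms(1) B I d by (intro finsum_lincomb_support) (auto simp: d_def)
    finally show ?thesis
      using d by blast
  qed
  ultimately show ?thesis
    using closed by (auto simp: bij_betw_def)
qed

end

text \<open>Reindexing along the inverse of \<open>f\<close> undoes it; the restrictions keep both
  maps within extensional functions.\<close>

lemma bij_betw_PiE_reindex:
  assumes "bij_betw f A B"
  shows "bij_betw (\<lambda>x. \<lambda>a\<in>A. x (f a)) (B \<rightarrow>\<^sub>E S) (A \<rightarrow>\<^sub>E S)"
proof (rule bij_betw_byWitness[where f' = "\<lambda>x. \<lambda>b\<in>B. x (inv_into A f b)"])
  note inv = bij_betwE[OF assms] bij_betwE[OF bij_betw_inv_into[OF assms]]
    bij_betw_inv_into_left[OF assms] bij_betw_inv_into_right[OF assms]
  show "\<forall>x\<in>B \<rightarrow>\<^sub>E S. (\<lambda>b\<in>B. (\<lambda>a\<in>A. x (f a)) (inv_into A f b)) = x"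
    using inv by (auto simp: fun_eq_iff PiE_iff extensional_def)
  show "\<forall>x\<in>A \<rightarrow>\<^sub>E S. (\<lambda>a\<in>A. (\<lambda>b\<in>B. x (inv_into A f b)) (f a)) = x"
    using inv by (auto simp: fun_eq_iff PiE_iff extensional_def)
qed (use bij_betwE[OF assms] bij_betwE[OF bij_betw_inv_into[OF assms]] in \<open>auto simp: PiE_iff\<close>)

text \<open>The value of the inverse at \<open>v\<close> is the only \<open>w\<close> in the carrier
  of \<open>W\<close> with \<open>S w = v\<close> (fact \<open>TI\<close>). So each equation for the
  inverse reduces to one for \<open>S\<close>.\<close>

lemma semi_linear_inv_into:
  assumes "semi_vector_space W" "semi_linear W V S" "bij_betw S (carrier W) (carrier V)"
  shows "semi_linear V W (inv_into (carrier W) S)"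
proof -
  interpret W: semi_vector_space W by fact
  let ?T = "inv_into (carrier W) S"
  have T: "?T v \<in> carrier W" "S (?T v) = v" if "v \<in> carrier V" for v
    using that assms(3) by (auto simp: bij_betw_def inv_into_into f_inv_into_f)
  have TI: "?T v = w" if "w \<in> carrier W" "S w = v" for v w
    using that assms(3) by (auto simp: bij_betw_def)
  show ?thesis
    using assms(2) T W.smult_closed unfolding semi_linear_def
    by (auto intro!: TI)
qed

theorem theorem3p2:
  fixes V :: "(real, 'v, 'm) module_scheme" and n :: nat
  assumes "simple_semi_vector_space V"
    and "semi_free V"
    and "semi_dim V = enat n"
  shows "\<exists>T. semi_linear V (nonneg_tuples n) T \<and>
    bij_betw T (carrier V) (carrier (nonneg_tuples n))"
proof -
  interpret simple_semi_vector_space V by fact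
  let ?W = "nonneg_tuples n"
  \<comment> \<open>This is the very semi-basis chosen in \<open>semi_dim\<close>, so its
    cardinality is known without comparing different semi-bases. It is finite because
    \<open>enat n\<close> is not \<infinity>.\<close>
  define B where "B = (SOME B. semi_basis V B)"
  have basis: "semi_basis V B"
    using assms(2) unfolding B_def semi_free_def by (rule someI_ex)
  have fin: "finite B" and card: "card B = n"
    using assms(3) by (auto simp: semi_dim_def B_def Let_def split: if_splits)
  have B: "B \<subseteq> carrier V"
    using basis by (auto simp: semi_basis_def)
  obtain f where f: "bij_betw f B {..<n}"
    using fin card by (metis ex_bij_betw_finite_nat lessThan_atLeast0)
  have fB: "f b < n" if "b \<in> B" for b
    using bij_betwE[OF f] that by auto
  \<comment> \<open>The map is built from tuples to \<open>V\<close>, where it has an explicit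
    formula; the required isomorphism is its inverse.\<close>
  define S where "S x = (\<Oplus>\<^bsub>V\<^esub>b\<in>B. x (f b) \<odot>\<^bsub>V\<^esub> b)" for x :: "nat \<Rightarrow> real"
  have nonneg: "(\<lambda>b. x (f b)) \<in> B \<rightarrow> {0..}" if "x \<in> carrier ?W" for x
    using that fB by (auto simp: nonneg_tuples_def PiE_iff)
  \<comment> \<open>Nonnegativity of \<open>d\<close> puts the terms in the carrier, a premise of
    \<open>finsum_cong'\<close>.\<close>
  have cong: "(\<Oplus>\<^bsub>V\<^esub>b\<in>B. c b \<odot>\<^bsub>V\<^esub> b) = (\<Oplus>\<^bsub>V\<^esub>b\<in>B. d b \<odot>\<^bsub>V\<^esub> b)"
    if "\<And>b. b \<in> B \<Longrightarrow> c b = d b" "d \<in> B \<rightarrow> {0..}" for c d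
    using that B smult_closed by (intro finsum_cong') (auto simp: Pi_iff subset_iff)
  have bij: "bij_betw S (carrier ?W) (carrier V)"
  proof -
    \<comment> \<open>A tuple is first turned into coefficients on \<open>B\<close> and then into a
      vector. The composite agrees with \<open>S\<close>, as the restriction to \<open>B\<close> is
      invisible under the sum.\<close>
    have "bij_betw ((\<lambda>c. \<Oplus>\<^bsub>V\<^esub>b\<in>B. c b \<odot>\<^bsub>V\<^esub> b) \<circ> (\<lambda>x. \<lambda>b\<in>B. x (f b)))
        (carrier ?W) (carrier V)"
      using bij_betw_trans[OF bij_betw_PiE_reindex[OF f] bij_betw_lincomb[OF fin basis]]
      by (simp add: nonneg_tuples_def)
    then show ?thesis
      by (rule bij_betw_cong[THEN iffD1, rotated]) (auto simp: S_def intro!: cong nonneg)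
  qed
  have W: "simple_semi_vector_space ?W"
    by (rule simple_semi_vector_space_nonneg_tuples)
  then interpret W: simple_semi_vector_space ?W .
  have "semi_linear ?W V S"
    unfolding semi_linear_def
  proof (intro conjI ballI allI impI)
    show "S \<in> carrier ?W \<rightarrow> carrier V"
      using bij_betwE[OF bij] by auto
  next
    fix x y assume xy: "x \<in> carrier ?W" "y \<in> carrier ?W"
    \<comment> \<open>Tuples are added coordinatewise only at indices below \<open>n\<close>, and
      \<open>fB\<close> keeps every \<open>f b\<close> in that range.\<close>
    have "S (x \<oplus>\<^bsub>?W\<^esub> y) = (\<Oplus>\<^bsub>V\<^esub>b\<in>B. (x (f b) + y (f b)) \<odot>\<^bsub>V\<^esub> b)"
      unfolding S_def using nonneg[OF xy(1)] nonneg[OF xy(2)] fB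
      by (intro cong) (auto simp: nonneg_tuples_def Pi_iff)
    then show "S (x \<oplus>\<^bsub>?W\<^esub> y) = S x \<oplus>\<^bsub>V\<^esub> S y"
      unfolding S_def using finsum_lincomb_add[OF B nonneg[OF xy(1)] nonneg[OF xy(2)]] by simp
  next
    fix a :: real and x assume ax: "0 \<le> a" "x \<in> carrier ?W"
    have "S (a \<odot>\<^bsub>?W\<^esub> x) = (\<Oplus>\<^bsub>V\<^esub>b\<in>B. (a * x (f b)) \<odot>\<^bsub>V\<^esub> b)"
      unfolding S_def using nonneg[OF ax(2)] ax(1) fB
      by (intro cong) (auto simp: nonneg_tuples_def Pi_iff)
    then show "S (a \<odot>\<^bsub>?W\<^esub> x) = a \<odot>\<^bsub>V\<^esub> S x"
      unfolding S_def using finsum_lincomb_smult[OF fin B ax(1) nonneg[OF ax(2)]] by simp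
  qed
  then show ?thesis
    using semi_linear_inv_into[OF W.semi_vector_space_axioms _ bij] bij_betw_inv_into[OF bij]
    by blast
qed

end
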